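(* Let $A\in\mathbb{R}^{n\times n}$, $C\in\mathbb{R}^{q\times n}$, and let $F\in\mathbb{R}^{r\times n}$ ($r\le n$) have linearly independent rows. Let $\mathcal{O}_F\subseteq\mathbb{R}^r$ be the functionally observable set of the system $(C,A;F)$ and let $\mathcal{C}_F\subseteq\mathbb{R}^r$ be the output controllable set of the dual system $(A^{\mathsf T},C^{\mathsf T};F)$. Then $\mathcal{O}_F\subseteq\mathcal{C}_F$. Therefore, if $(C,A;F)$ is functionally observable, then $(A^{\mathsf T},C^{\mathsf T};F)$ is output controllable.
   Context: Fix a final time $t_1>0$. Consider linear time-invariant systems $\dot{x}=\mathsf{A}x+\mathsf{B}u$, $y=\mathsf{C}x$, with target vector $z=Fx\in\mathbb{R}^r$. Output controllability. The triple $(\mathsf{A},\mathsf{B};F)$ denotes the system with system matrix $\mathsf{A}$, input matrix $\mathsf{B}$ and functional matrix $F$. Its output controllable set is the set of all $z^*\in\mathbb{R}^r$ for which there is an input $u(t)$, $t\in[0,t_1]$, steering the system from $x(0)=0$ to some $x(t_1)$ with $Fx(t_1)=z^*$. Equivalently, it is $F\operatorname{Im}(W_c)$ with $W_c=\int_0^{t_1}e^{\mathsf{A}(t_1-\tau)}\mathsf{B}\mathsf{B}^{\mathsf T}e^{\mathsf{A}^{\mathsf T}(t_1-\tau)}\,d\tau$. The system is output controllable when this set equals $\mathbb{R}^r$; equivalently $\operatorname{rank}(F[\mathsf{B}\ \mathsf{A}\mathsf{B}\ \cdots\ \mathsf{A}^{n-1}\mathsf{B}])=\operatorname{rank}(F)$.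 Here the system considered is the dual one: $\mathsf{A}=A^{\mathsf T}$, $\mathsf{B}=C^{\mathsf T}$. Functional observability. The triple $(C,A;F)$ denotes the system with output matrix $C$, system matrix $A$ and functional matrix $F$. Its functionally observable set $\mathcal{O}_F$ is the set of all $z^*\in\mathbb{R}^r$ such that $z(0)=Fx(0)=z^*$ can be uniquely determined from the output $y(t)$ and input $u(t)$ over $[0,t_1]$; explicitly, $$\mathcal{O}_F=\{z^*\in\mathbb{R}^r:\ z^*\perp F\operatorname{Ker}(W_o)\ \text{and}\ z^*\in F\operatorname{Im}(W_o)\},\qquad W_o=\int_0^{t_1}e^{A^{\mathsf T}\tau}C^{\mathsf T}Ce^{A\tau}\,d\tau .$$ The system is functionally observable when $\mathcal{O}_F=\mathbb{R}^r$; equivalently $\operatorname{rank}\begin{bmatrix}\mathcal{O}\\ F\end{bmatrix}=\operatorname{rank}(\mathcal{O})$ with $\mathcal{O}=[C^{\mathsf T}\ (CA)^{\mathsf T}\ \cdots\ (CA^{n-1})^{\mathsf T}]^{\mathsf T}$. *)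

theory Defs
  imports "HOL-Analysis.Analysis"
begin

text \<open>The class operations \<open>*\<close>, \<open>1\<close>, \<open>^\<close> on \<^typ>\<open>real ^ 'n ^ 'n\<close> act entrywise, so powers and the
  exponential are built from the matrix product \<open>**\<close>.\<close>

definition matrix_power :: "real ^ 'n ^ 'n \<Rightarrow> nat \<Rightarrow> real ^ 'n ^ 'n" where
  "matrix_power A k = (((**) A) ^^ k) (mat 1)"

definition matrix_exp :: "real ^ 'n ^ 'n \<Rightarrow> real ^ 'n ^ 'n" where
  "matrix_exp A = (\<Sum>k. matrix_power A k /\<^sub>R fact k)"

lemma bounded_bilinear_matrix_mult:
  "bounded_bilinear ((**) :: real ^ 'n ^ 'm \<Rightarrow> real ^ 'k ^ 'n \<Rightarrow> real ^ 'k ^ 'm)"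
  by (rule bilinear_conv_bounded_bilinear[THEN iffD1])
     (auto simp: bilinear_def intro!: linearI
       simp: vec_eq_iff matrix_matrix_mult_def sum.distrib sum_distrib_left algebra_simps)

text \<open>The exponential series converges, so \<^const>\<open>suminf\<close> above has its intended value.\<close>

lemma summable_matrix_exp:
  fixes A :: "real ^ 'n ^ 'n"
  shows "summable (\<lambda>k. matrix_power A k /\<^sub>R fact k)"
proof -
  obtain K where K: "K > 0"
    and mult: "\<And>(X :: real ^ 'n ^ 'n) (Y :: real ^ 'n ^ 'n). norm (X ** Y) \<le> norm X * norm Y * K"
    using bounded_bilinear.pos_bounded[OF bounded_bilinear_matrix_mult] by metis
  have bound: "norm (matrix_power A k) \<le> norm (mat 1 :: real ^ 'n ^ 'n) * (norm A * K) ^ k" for k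
  proof (induction k)
    case (Suc k)
    have "norm (matrix_power A (Suc k)) \<le> norm A * norm (matrix_power A k) * K"
      using mult[of A "matrix_power A k"] by (simp add: matrix_power_def)
    also have "\<dots> \<le> norm A * (norm (mat 1 :: real ^ 'n ^ 'n) * (norm A * K) ^ k) * K"
      using Suc K by (intro mult_right_mono mult_left_mono) auto
    finally show ?case by (simp add: mult_ac)
  qed (simp add: matrix_power_def)
  have "summable (\<lambda>k. norm (mat 1 :: real ^ 'n ^ 'n) * ((norm A * K) ^ k /\<^sub>R fact k))"
    by (intro summable_mult summable_exp_generic)
  then show ?thesis
    by (rule summable_comparison_test[rotated])
       (use bound in \<open>auto intro!: exI[of _ 0] simp: divide_simps mult_ac\<close>)
qed

text \<open>Inputs are piecewise continuous: finitely many discontinuities, with one-sided limits at each.\<close>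

definition piecewise_continuous :: "real \<Rightarrow> real \<Rightarrow> (real \<Rightarrow> 'a::topological_space) \<Rightarrow> bool" where
  "piecewise_continuous a b u \<longleftrightarrow>
     (\<exists>S. finite S \<and> continuous_on ({a..b} - S) u) \<and>
     (\<forall>t\<in>{a..<b}. \<exists>l. (u \<longlongrightarrow> l) (at_right t)) \<and>
     (\<forall>t\<in>{a<..b}. \<exists>l. (u \<longlongrightarrow> l) (at_left t))"

text \<open>\<open>x' = A x + B u\<close> on \<open>[0, t1]\<close>. A continuous state need not be differentiable where the
  input jumps, so finitely many times are exempted.\<close>

definition state_trajectory ::
  "real \<Rightarrow> real ^ 'n ^ 'n \<Rightarrow> real ^ 'm ^ 'n \<Rightarrow> (real \<Rightarrow> real ^ 'm) \<Rightarrow> (real \<Rightarrow> real ^ 'n) \<Rightarrow> bool" where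
  "state_trajectory t1 A B u x \<longleftrightarrow>
     continuous_on {0..t1} x \<and>
     (\<exists>S. finite S \<and> (\<forall>t\<in>{0..t1} - S.
        (x has_vector_derivative (A *v x t + B *v u t)) (at t within {0..t1})))"

definition output_controllable_set ::
  "real \<Rightarrow> real ^ 'n ^ 'n \<Rightarrow> real ^ 'm ^ 'n \<Rightarrow> real ^ 'n ^ 'r \<Rightarrow> (real ^ 'r) set" where
  "output_controllable_set t1 A B F =
     {z. \<exists>u x. piecewise_continuous 0 t1 u \<and> state_trajectory t1 A B u x \<and>
               x 0 = 0 \<and> F *v x t1 = z}"

definition output_controllable ::
  "real \<Rightarrow> real ^ 'n ^ 'n \<Rightarrow> real ^ 'm ^ 'n \<Rightarrow> real ^ 'n ^ 'r \<Rightarrow> bool" where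
  "output_controllable t1 A B F \<longleftrightarrow> output_controllable_set t1 A B F = UNIV"

definition observability_gramian ::
  "real \<Rightarrow> real ^ 'n ^ 'q \<Rightarrow> real ^ 'n ^ 'n \<Rightarrow> real ^ 'n ^ 'n" where
  "observability_gramian t1 C A =
     integral {0..t1} (\<lambda>\<tau>. matrix_exp (\<tau> *\<^sub>R transpose A) ** transpose C ** C ** matrix_exp (\<tau> *\<^sub>R A))"

definition functionally_observable_set ::
  "real \<Rightarrow> real ^ 'n ^ 'q \<Rightarrow> real ^ 'n ^ 'n \<Rightarrow> real ^ 'n ^ 'r \<Rightarrow> (real ^ 'r) set" where
  "functionally_observable_set t1 C A F =
     (let W = observability_gramian t1 C A in
      {z. (\<forall>w \<in> (*v) F ` {x. W *v x = 0}. orthogonal z w) \<and> z \<in> (*v) F ` range ((*v) W)})"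

definition functionally_observable ::
  "real \<Rightarrow> real ^ 'n ^ 'q \<Rightarrow> real ^ 'n ^ 'n \<Rightarrow> real ^ 'n ^ 'r \<Rightarrow> bool" where
  "functionally_observable t1 C A F \<longleftrightarrow> functionally_observable_set t1 C A F = UNIV"

end

(* A vector z = F W w, with W the observability Gramian, is reached by the input
   u(t) = C exp((t1 - t) A) w: variation of constants gives the final state W w. *)
theory Submission
  imports Defs
begin

text \<open>Up to the reflection of time s to t1 - s, the observability Gramian W of (C, A) is the
  controllability Gramian of the dual system (A^T, C^T), so every state W w can be reached by the
  dual from 0. A functionally observable z has the form F W w, so it is the target value of such a
  state; the claim on the full space follows from the inclusion. Controllable sets are defined by
  trajectories and not by a Gramian, so a trajectory must be exhibited.
  \<open>state_trajectory_variation_of_constants\<close> supplies one for each continuous input, and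
  \<open>observability_gramian_mult\<close> recognizes W w as its value at t1 for the input u(t) = C
  exp((t1 - t) A) w. Both rest on two facts about the exponential: exp(tA) has derivative A exp(tA),
  and exp((t + s) A) = exp(tA) exp(sA).\<close>

lemma bounded_bilinear_matrix_vector_mult:
  "bounded_bilinear ((*v) :: real ^ 'n ^ 'm \<Rightarrow> real ^ 'n \<Rightarrow> real ^ 'm)"
  by (rule bilinear_conv_bounded_bilinear[THEN iffD1])
     (auto simp: bilinear_def algebra_simps scaleR_matrix_vector_assoc intro!: linearI)

text \<open>Affine substitution with slope -1, which maps the interval onto itself. It supplies the
  time reversal between the Gramian and the reachable states of the dual.\<close>

lemma integral_reflect_interval:
  fixes f :: "real \<Rightarrow> 'a::real_normed_vector"
  assumes "f integrable_on {0..a}"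
  shows "integral {0..a} (\<lambda>s. f (a - s)) = integral {0..a} f"
proof -
  have "(\<lambda>x. a - x) ` {0..a} = {0..a}"
    by simp
  then show ?thesis
    using has_integral_affinity[of f "integral {0..a} f" 0 a "-1" a] integrable_integral[OF assms]
    by (intro integral_unique) simp
qed

lemma matrix_power_0 [simp]: "matrix_power A 0 = mat 1"
  and matrix_power_Suc: "matrix_power A (Suc k) = A ** matrix_power A k"
  by (simp_all add: matrix_power_def)

lemma matrix_power_commute: "matrix_power A k ** A = A ** matrix_power A k"
  by (induction k) (simp_all add: matrix_power_Suc matrix_mul_assoc[symmetric])

lemma matrix_power_scaleR: "matrix_power (t *\<^sub>R A) k = t ^ k *\<^sub>R matrix_power A k"
  by (induction k)
     (simp_all add: matrix_power_Suc
        bounded_bilinear.scaleR_left[OF bounded_bilinear_matrix_mult]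
        bounded_bilinear.scaleR_right[OF bounded_bilinear_matrix_mult])

text \<open>Reads exp(tA) as a power series in the scalar t with matrix coefficients, the form used
  by the calculus below.\<close>

lemma sums_matrix_exp_scaleR:
  "(\<lambda>k. (t ^ k / fact k) *\<^sub>R matrix_power A k) sums matrix_exp (t *\<^sub>R A)"
  using summable_sums[OF summable_matrix_exp[of "t *\<^sub>R A"]]
  unfolding matrix_exp_def by (simp add: matrix_power_scaleR divide_inverse mult.commute)

lemma matrix_exp_0 [simp]: "matrix_exp 0 = mat 1"
proof -
  have "(\<lambda>k. (0 ^ k / fact k) *\<^sub>R matrix_power (0 :: real ^ 'a ^ 'a) k) sums mat 1"
    using sums_finite[of "{0}" "\<lambda>k. (0 ^ k / fact k) *\<^sub>R matrix_power (0 :: real ^ 'a ^ 'a) k"]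
    by simp
  then show ?thesis
    using sums_matrix_exp_scaleR[of 0 "0 :: real ^ 'a ^ 'a"]
    by (simp only: scaleR_zero_left sums_unique2)
qed

text \<open>A commutes with each term of the series, and multiplication by A on either side is
  bounded linear, so it passes through the sum.\<close>

lemma matrix_exp_commute: "matrix_exp (t *\<^sub>R A) ** A = A ** matrix_exp (t *\<^sub>R A)"
proof -
  note bl = bounded_bilinear_matrix_mult
  have "(\<lambda>k. ((t ^ k / fact k) *\<^sub>R matrix_power A k) ** A) sums (matrix_exp (t *\<^sub>R A) ** A)"
    by (rule bounded_linear.sums[OF bounded_bilinear.bounded_linear_left[OF bl] sums_matrix_exp_scaleR])
  then have "(\<lambda>k. A ** ((t ^ k / fact k) *\<^sub>R matrix_power A k)) sums (matrix_exp (t *\<^sub>R A) ** A)"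
    by (simp only: bounded_bilinear.scaleR_left[OF bl] bounded_bilinear.scaleR_right[OF bl]
          matrix_power_commute)
  moreover
  have "(\<lambda>k. A ** ((t ^ k / fact k) *\<^sub>R matrix_power A k)) sums (A ** matrix_exp (t *\<^sub>R A))"
    by (rule bounded_linear.sums[OF bounded_bilinear.bounded_linear_right[OF bl] sums_matrix_exp_scaleR])
  ultimately show ?thesis
    by (rule sums_unique2)
qed

text \<open>Each entry is a real power series that converges everywhere, so it may be differentiated
  term by term.\<close>

lemma has_vector_derivative_matrix_exp:
  "((\<lambda>t. matrix_exp (t *\<^sub>R A)) has_vector_derivative (A ** matrix_exp (t *\<^sub>R A))) (at t)"
proof -
  note bl = bounded_bilinear_matrix_mult
  have entry: "((\<lambda>t. matrix_exp (t *\<^sub>R A) $ i $ j) has_real_derivative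
                  (A ** matrix_exp (t *\<^sub>R A)) $ i $ j) (at t)" for i j
  proof -
    define c where "c k = matrix_power A k $ i $ j / fact k" for k
    have comp: "bounded_linear (\<lambda>M :: real ^ 'a ^ 'a. M $ i $ j)"
      by (intro bounded_linear_compose[OF bounded_linear_vec_nth bounded_linear_vec_nth])
    have c: "(\<lambda>k. c k * s ^ k) sums (matrix_exp (s *\<^sub>R A) $ i $ j)" for s
      using bounded_linear.sums[OF comp sums_matrix_exp_scaleR[of s A]]
      by (simp add: c_def mult.commute)
    have "(\<lambda>k. A ** ((t ^ k / fact k) *\<^sub>R matrix_power A k)) sums (A ** matrix_exp (t *\<^sub>R A))"
      by (rule bounded_linear.sums[OF bounded_bilinear.bounded_linear_right[OF bl] sums_matrix_exp_scaleR])
    from bounded_linear.sums[OF comp this]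
    \<comment> \<open>The coefficient \<open>diffs c k\<close> is (k + 1) times the entry of A^(k+1)
      / (k+1)!, that is, the entry of A A^k / k!.\<close>
    have "(\<lambda>k. diffs c k * t ^ k) sums ((A ** matrix_exp (t *\<^sub>R A)) $ i $ j)"
      by (simp add: bounded_bilinear.scaleR_right[OF bl] diffs_def c_def matrix_power_Suc
            mult.commute del: of_nat_Suc)
    moreover have "((\<lambda>s. \<Sum>k. c k * s ^ k) has_real_derivative (\<Sum>k. diffs c k * t ^ k)) (at t)"
      using c by (intro termdiffs_strong_converges_everywhere) (blast intro: sums_summable)
    ultimately show ?thesis
      using c by (simp add: sums_iff)
  qed
  show ?thesis
    unfolding has_vector_derivative_def
    by (subst has_derivative_componentwise_within)
       (auto simp: Basis_vec_def inner_axis has_field_derivative_def mult.commute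
          intro!: has_derivative_eq_rhs[OF entry[unfolded has_field_derivative_def]])
qed

lemma continuous_on_matrix_exp [continuous_intros]:
  fixes A :: "real ^ 'n ^ 'n"
  assumes "continuous_on S f"
  shows "continuous_on S (\<lambda>x. matrix_exp (f x *\<^sub>R A))"
proof -
  have "continuous_on UNIV (\<lambda>t. matrix_exp (t *\<^sub>R A))"
    by (rule continuous_on_vector_derivative)
       (use has_vector_derivative_matrix_exp[of A] in simp)
  then show ?thesis
    using continuous_on_compose2[OF _ assms] by blast
qed

text \<open>As a function of t the left side has derivative zero, so it equals its value at t = 0.
  Both the inverse of exp(tA) and the addition law are instances.\<close>

lemma matrix_exp_minus_mult_add:
  "matrix_exp ((- t) *\<^sub>R A) ** matrix_exp ((t + s) *\<^sub>R A) = matrix_exp (s *\<^sub>R A)"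
proof -
  let ?E = "\<lambda>t. matrix_exp (t *\<^sub>R A)"
  have D: "((\<lambda>t. ?E (- t) ** ?E (t + s)) has_vector_derivative 0) (at t)" for t
  proof -
    have "((\<lambda>t. ?E (- t)) has_vector_derivative (- (A ** ?E (- t)))) (at t)"
      using vector_diff_chain_at[of uminus "-1" t ?E, unfolded o_def,
          OF has_vector_derivative_minus[OF has_vector_derivative_id]
            has_vector_derivative_matrix_exp]
      by simp
    moreover have shift: "((\<lambda>t. t + s) has_vector_derivative 1) (at t)"
      by (auto intro!: derivative_eq_intros)
    have "((\<lambda>t. ?E (t + s)) has_vector_derivative (A ** ?E (t + s))) (at t)"
      using vector_diff_chain_at[of "\<lambda>t. t + s" 1 t ?E, unfolded o_def,
          OF shift has_vector_derivative_matrix_exp]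
      by simp
    ultimately have "((\<lambda>t. ?E (- t) ** ?E (t + s)) has_vector_derivative
        (?E (- t) ** (A ** ?E (t + s)) + (- (A ** ?E (- t))) ** ?E (t + s))) (at t)"
      by (rule bounded_bilinear.has_vector_derivative[OF bounded_bilinear_matrix_mult])
    \<comment> \<open>The two terms of the product rule cancel because A commutes with
      exp(-tA).\<close>
    then show ?thesis
      by (simp add: bounded_bilinear.minus_left[OF bounded_bilinear_matrix_mult]
            matrix_mul_assoc matrix_exp_commute[of "- t", simplified])
  qed
  obtain c where c: "\<And>t. t \<in> UNIV \<Longrightarrow> ?E (- t) ** ?E (t + s) = c"
    by (rule has_vector_derivative_zero_constant[of UNIV "\<lambda>t. ?E (- t) ** ?E (t + s)"])
       (use D in \<open>blast intro: convex_UNIV\<close>)+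
  from c[of t] c[of 0] show ?thesis
    by simp
qed

lemma matrix_exp_mult_minus:
  "matrix_exp (t *\<^sub>R A) ** matrix_exp ((- t) *\<^sub>R A) = mat 1"
  using matrix_exp_minus_mult_add[of "- t" A 0] by simp

lemma matrix_exp_add:
  "matrix_exp ((t + s) *\<^sub>R A) = matrix_exp (t *\<^sub>R A) ** matrix_exp (s *\<^sub>R A)"
  using matrix_exp_minus_mult_add[of "- t" A "t + s"] by simp

lemma continuous_imp_piecewise_continuous:
  assumes "continuous_on UNIV u"
  shows "piecewise_continuous a b u"
proof -
  have "(u \<longlongrightarrow> u t) (at_right t)" "(u \<longlongrightarrow> u t) (at_left t)" for t
    using assms by (auto simp: continuous_on_def filterlim_at_split)
  moreover have "continuous_on ({a..b} - {}) u"
    using assms continuous_on_subset by blast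
  ultimately show ?thesis
    unfolding piecewise_continuous_def by blast
qed

text \<open>The factor exp(tA) stands outside the integral, so the integrand does not depend on t:
  the product rule and the fundamental theorem of calculus then give the derivative. For continuous
  u it exists at every time, so the exceptional set is empty.\<close>

lemma state_trajectory_variation_of_constants:
  fixes A :: "real ^ 'n ^ 'n" and B :: "real ^ 'm ^ 'n"
  assumes "continuous_on {0..t1} u"
  shows "state_trajectory t1 A B u
    (\<lambda>t. matrix_exp (t *\<^sub>R A) *v integral {0..t} (\<lambda>s. matrix_exp ((- s) *\<^sub>R A) *v (B *v u s)))"
    (is "state_trajectory t1 A B u ?x")
proof -
  let ?E = "\<lambda>t. matrix_exp (t *\<^sub>R A)"
  let ?g = "\<lambda>s. ?E (- s) *v (B *v u s)"
  have cont: "continuous_on {0..t1} ?g"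
    by (intro bounded_bilinear.continuous_on[OF bounded_bilinear_matrix_vector_mult]
        continuous_intros assms)
  have deriv: "(?x has_vector_derivative (A *v ?x t + B *v u t)) (at t within {0..t1})"
    if t: "t \<in> {0..t1}" for t
  proof -
    have "(?x has_vector_derivative
        (?E t *v ?g t + (A ** ?E t) *v integral {0..t} ?g)) (at t within {0..t1})"
      by (intro bounded_bilinear.has_vector_derivative[OF bounded_bilinear_matrix_vector_mult]
          has_vector_derivative_at_within[OF has_vector_derivative_matrix_exp]
          integral_has_vector_derivative[OF cont t])
    \<comment> \<open>Here exp(tA) and exp(-tA) cancel, which leaves the input term.\<close>
    moreover have "?E t *v ?g t = B *v u t"
      by (metis matrix_exp_mult_minus matrix_vector_mul_assoc matrix_vector_mul_lid)
    ultimately show ?thesis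
      by (simp add: matrix_vector_mul_assoc add.commute)
  qed
  moreover from deriv have "continuous_on {0..t1} ?x"
    by (rule continuous_on_vector_derivative)
  ultimately show ?thesis
    unfolding state_trajectory_def by blast
qed

text \<open>The right side is the variation-of-constants state of the dual system at time t1, for
  the input C exp((t1 - s) A) w.\<close>

lemma observability_gramian_mult:
  fixes A :: "real ^ 'n ^ 'n" and C :: "real ^ 'n ^ 'q"
  shows "observability_gramian t1 C A *v w = matrix_exp (t1 *\<^sub>R transpose A) *v
    integral {0..t1} (\<lambda>s. matrix_exp ((- s) *\<^sub>R transpose A) *v
      (transpose C *v (C *v (matrix_exp ((t1 - s) *\<^sub>R A) *v w))))"
proof -
  let ?E = "\<lambda>t. matrix_exp (t *\<^sub>R transpose A)" and ?M = "\<lambda>t. matrix_exp (t *\<^sub>R A)"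
  let ?G = "\<lambda>s. ?E s ** transpose C ** C ** ?M s"
  let ?g = "\<lambda>s. ?E (- s) *v (transpose C *v (C *v (?M (t1 - s) *v w)))"
  note cont = bounded_bilinear.continuous_on[OF bounded_bilinear_matrix_mult]
    bounded_bilinear.continuous_on[OF bounded_bilinear_matrix_vector_mult]
  have "?G integrable_on {0..t1}"
    by (intro integrable_continuous_real cont continuous_intros)
  from integral_linear[OF this
      bounded_bilinear.bounded_linear_left[OF bounded_bilinear_matrix_vector_mult, of w]]
  have "observability_gramian t1 C A *v w = integral {0..t1} (\<lambda>s. ?G s *v w)"
    unfolding observability_gramian_def o_def by (rule sym)
  also have "\<dots> = integral {0..t1} (\<lambda>s. ?G (t1 - s) *v w)"
    by (intro integral_reflect_interval[symmetric] integrable_continuous_real cont continuous_intros)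
  \<comment> \<open>The addition law splits exp((t1 - s) A^T) into exp(t1 A^T) exp(-s A^T); the
    first factor is constant in s and then leaves the integral.\<close>
  also have "\<dots> = integral {0..t1} (\<lambda>s. ?E t1 *v ?g s)"
    using matrix_exp_add[of t1 "- s" "transpose A" for s]
    by (simp add: matrix_vector_mul_assoc matrix_mul_assoc)
  also have "\<dots> = ?E t1 *v integral {0..t1} ?g"
  proof -
    have "?g integrable_on {0..t1}"
      by (intro integrable_continuous_real cont continuous_intros)
    then show ?thesis
      using integral_linear[OF _ matrix_vector_mul_bounded_linear[of "?E t1"]] by (simp add: o_def)
  qed
  finally show ?thesis .
qed

lemma range_observability_gramian_subset_output_controllable_set:
  fixes A :: "real ^ 'n ^ 'n" and C :: "real ^ 'n ^ 'q" and F :: "real ^ 'n ^ 'r"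
  shows "(*v) F ` range ((*v) (observability_gramian t1 C A))
    \<subseteq> output_controllable_set t1 (transpose A) (transpose C) F"
proof clarify
  fix w :: "real ^ 'n"
  let ?u = "\<lambda>t. C *v (matrix_exp ((t1 - t) *\<^sub>R A) *v w)"
  have u: "continuous_on S ?u" for S
    by (intro bounded_bilinear.continuous_on[OF bounded_bilinear_matrix_vector_mult]
        continuous_intros)
  show "F *v (observability_gramian t1 C A *v w)
    \<in> output_controllable_set t1 (transpose A) (transpose C) F"
    unfolding output_controllable_set_def mem_Collect_eq observability_gramian_mult
    \<comment> \<open>The trajectory is left open and is fixed by the variation-of-constants rule.
      It vanishes at 0 because its integral runs over a single point, and its final state is already
      the rewritten W w.\<close>
    by (rule exI[of _ ?u], rule exI, intro conjI, rule continuous_imp_piecewise_continuous[OF u],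
        rule state_trajectory_variation_of_constants[OF u]) simp_all
qed

theorem theorem1:
  fixes t1 :: real
    and A :: "real ^ 'n ^ 'n"
    and C :: "real ^ 'n ^ 'q"
    and F :: "real ^ 'n ^ 'r"
  assumes "t1 > 0"
    and "CARD('r) \<le> CARD('n)"
    and "inj (\<lambda>i. row i F)" and "independent (rows F)"
  shows "functionally_observable_set t1 C A F
           \<subseteq> output_controllable_set t1 (transpose A) (transpose C) F \<and>
         (functionally_observable t1 C A F
           \<longrightarrow> output_controllable t1 (transpose A) (transpose C) F)"
proof -
  have "functionally_observable_set t1 C A F
      \<subseteq> output_controllable_set t1 (transpose A) (transpose C) F"
    \<comment> \<open>The condition that z lies in F Im(W) is part of the definition of the
      functionally observable set.\<close>
    using range_observability_gramian_subset_output_controllable_set[of F t1 C A]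
    unfolding functionally_observable_set_def Let_def by blast
  then show ?thesis
    unfolding functionally_observable_def output_controllable_def by blast
qed

end
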